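(* Let $m\ge 2$ and let $G_0,\dots,G_{m-1}$ (indices in $\mathbb{Z}_m$) be $4$-graphs with vertex partitions $V(G_i)=V_i'\cup V_i''$. Suppose that for every $i\in\mathbb{Z}_m$ there is an integer $\alpha_i$ with $\alpha(G_i)=\alpha_i+1$, $\alpha(G_i\cap V_i')\le\alpha_i$ and $\alpha(G_i\cap V_i'')\le\alpha_i$. Let $A$ be an independent set in $C_m[G_0,\dots,G_{m-1}]$, and for $i\in\mathbb{Z}_m$ let $\chi_i=0$ if $A\cap W_i=\emptyset$ and $\chi_i=1$ otherwise. Then $|A|\le\sum_{i\in\mathbb{Z}_m}(\alpha_i-1+\chi_i)$.
   Context: A $4$-graph has a finite vertex set and edges which are $4$-element vertex subsets; a vertex set is independent if it contains no edge; $\alpha(\cdot)$ is the maximum size of an independent set; $G\cap U$ denotes the subgraph of $G$ induced by $U$. Circular construction: given $4$-graphs $G_i$, $i\in\mathbb{Z}_m$ ($m\ge2$), with $V(G_i)=V_i'\cup V_i''$ (disjoint), let $W_i=V_i'\times V_{i+1}''$ (the sets $W_i$ regarded as pairwise disjoint), and for $x\in V_i'$ let $W_{i,x}=\{(x,y):y\in V_{i+1}''\}$. For $A\subseteq\bigcup_i W_i$, $\beta_i(A)$ is the number of $x\in V_i'$ with $W_{i,x}\cap A\neq\emptyset$. Define $h_i:W_i\cup W_{i+1}\to V(G_{i+1})$ by $h_i((x,y))=y\in V_{i+1}''$ if $(x,y)\in W_i$ and $h_i((x,y))=x\in V_{i+1}'$ if $(x,y)\in W_{i+1}$. Let $E_i^1$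 be the set of $4$-sets $\{w_1,\dots,w_4\}\subseteq W_i\cup W_{i+1}$ with $\beta_i(\{w_1,\dots,w_4\})=1$ such that $h_i(w_1),\dots,h_i(w_4)$ form an edge of $G_{i+1}$. Let $E_i^2$ be the set of $4$-sets $\{w_1,\dots,w_4\}\subseteq W_i$, $w_j=(x_j,y_j)$, with $x_1=x_2$ and $x_3=x_4\ne x_1$. Let $E_i^4$ be the set of $4$-sets $\{w_1,\dots,w_4\}\subseteq W_i$, $w_j=(x_j,y_j)$, with $x_1,\dots,x_4$ pairwise distinct forming an edge of $G_i$. Then $C_m[G_0,\dots,G_{m-1}]$ is the $4$-graph with vertex set $\bigcup_{i\in\mathbb{Z}_m}W_i$ and edge set $\bigcup_{i\in\mathbb{Z}_m}(E_i^1\cup E_i^2\cup E_i^4)$. *)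

theory Defs
  imports Main
begin

record 'a hypergraph =
  verts :: "'a set"
  edges :: "'a set set"

definition four_graph :: "'a hypergraph \<Rightarrow> bool" where
  "four_graph G \<longleftrightarrow> finite (verts G) \<and> (\<forall>e\<in>edges G. e \<subseteq> verts G \<and> card e = 4)"

definition independent_set :: "'a hypergraph \<Rightarrow> 'a set \<Rightarrow> bool" where
  "independent_set G S \<longleftrightarrow> S \<subseteq> verts G \<and> (\<forall>e\<in>edges G. \<not> e \<subseteq> S)"

(* On a four_graph the maximum ranges over a finite nonempty set ({} is independent). *)
definition independence_number :: "'a hypergraph \<Rightarrow> nat" where
  "independence_number G = Max (card ` {S. independent_set G S})"

definition induced :: "'a hypergraph \<Rightarrow> 'a set \<Rightarrow> 'a hypergraph" where
  "induced G U = \<lparr>verts = verts G \<inter> U, edges = {e \<in> edges G. e \<subseteq> U}\<rparr>"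

(* Circular construction.  Elements of Z_m are the naturals i < m, with successor Suc i mod m.
   P i and Q i are the two parts V_i' and V_i'' of verts (G i).  A vertex (x, y) of W_i is
   represented by the triple (i, x, y), which makes the sets W_i pairwise disjoint. *)

definition circ_W :: "nat \<Rightarrow> (nat \<Rightarrow> 'a set) \<Rightarrow> (nat \<Rightarrow> 'a set) \<Rightarrow> nat \<Rightarrow> (nat \<times> 'a \<times> 'a) set" where
  "circ_W m P Q i = {i} \<times> P i \<times> Q (Suc i mod m)"

definition circ_fibre :: "nat \<Rightarrow> (nat \<Rightarrow> 'a set) \<Rightarrow> nat \<Rightarrow> 'a \<Rightarrow> (nat \<times> 'a \<times> 'a) set" where
  "circ_fibre m Q i x = {(i, x, y) | y. y \<in> Q (Suc i mod m)}"

definition circ_beta ::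
  "nat \<Rightarrow> (nat \<Rightarrow> 'a set) \<Rightarrow> (nat \<Rightarrow> 'a set) \<Rightarrow> nat \<Rightarrow> (nat \<times> 'a \<times> 'a) set \<Rightarrow> nat" where
  "circ_beta m P Q i A = card {x \<in> P i. circ_fibre m Q i x \<inter> A \<noteq> {}}"

(* Only used on W_i \<union> W_(i+1); well behaved because i and i+1 differ in Z_m for m \<ge> 2. *)
definition circ_h :: "nat \<Rightarrow> nat \<times> 'a \<times> 'a \<Rightarrow> 'a" where
  "circ_h i w = (case w of (j, x, y) \<Rightarrow> if j = i then y else x)"

definition circ_E1 ::
  "nat \<Rightarrow> (nat \<Rightarrow> 'a hypergraph) \<Rightarrow> (nat \<Rightarrow> 'a set) \<Rightarrow> (nat \<Rightarrow> 'a set) \<Rightarrow> nat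
    \<Rightarrow> (nat \<times> 'a \<times> 'a) set set" where
  "circ_E1 m G P Q i =
    {e. card e = 4 \<and> e \<subseteq> circ_W m P Q i \<union> circ_W m P Q (Suc i mod m) \<and>
        circ_beta m P Q i e = 1 \<and> circ_h i ` e \<in> edges (G (Suc i mod m))}"

definition circ_E2 ::
  "nat \<Rightarrow> (nat \<Rightarrow> 'a set) \<Rightarrow> (nat \<Rightarrow> 'a set) \<Rightarrow> nat \<Rightarrow> (nat \<times> 'a \<times> 'a) set set" where
  "circ_E2 m P Q i =
    {e. card e = 4 \<and> e \<subseteq> circ_W m P Q i \<and>
        (\<exists>x1 x2 x3 x4 y1 y2 y3 y4.
           e = {(i, x1, y1), (i, x2, y2), (i, x3, y3), (i, x4, y4)} \<and>
           x1 = x2 \<and> x3 = x4 \<and> x4 \<noteq> x1)}"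

definition circ_E4 ::
  "nat \<Rightarrow> (nat \<Rightarrow> 'a hypergraph) \<Rightarrow> (nat \<Rightarrow> 'a set) \<Rightarrow> (nat \<Rightarrow> 'a set) \<Rightarrow> nat
    \<Rightarrow> (nat \<times> 'a \<times> 'a) set set" where
  "circ_E4 m G P Q i =
    {e. card e = 4 \<and> e \<subseteq> circ_W m P Q i \<and>
        (\<exists>x1 x2 x3 x4 y1 y2 y3 y4.
           e = {(i, x1, y1), (i, x2, y2), (i, x3, y3), (i, x4, y4)} \<and>
           distinct [x1, x2, x3, x4] \<and> {x1, x2, x3, x4} \<in> edges (G i))}"

definition circ ::
  "nat \<Rightarrow> (nat \<Rightarrow> 'a hypergraph) \<Rightarrow> (nat \<Rightarrow> 'a set) \<Rightarrow> (nat \<Rightarrow> 'a set)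
    \<Rightarrow> (nat \<times> 'a \<times> 'a) hypergraph" where
  "circ m G P Q =
    \<lparr>verts = (\<Union>i<m. circ_W m P Q i),
     edges = (\<Union>i<m. circ_E1 m G P Q i \<union> circ_E2 m P Q i \<union> circ_E4 m G P Q i)\<rparr>"

lemma four_graph_circ:
  assumes "\<And>i. i < m \<Longrightarrow> four_graph (G i)"
    and "\<And>i. i < m \<Longrightarrow> verts (G i) = P i \<union> Q i"
  shows "four_graph (circ m G P Q)"
proof -
  have fin: "finite (P i)" "finite (Q i)" if "i < m" for i
    using assms[OF that] by (auto simp: four_graph_def)
  have W: "finite (circ_W m P Q i)" if "i < m" for i
    using that fin(1)[of i] fin(2)[of "Suc i mod m"] by (auto simp: circ_W_def)
  have S: "circ_W m P Q (Suc i mod m) \<subseteq> (\<Union>i<m. circ_W m P Q i)" if "i < m" for i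
    using that by (intro UN_upper) auto
  show ?thesis
    unfolding four_graph_def
  proof (intro conjI ballI)
    show "finite (verts (circ m G P Q))"
      using W by (auto simp: circ_def)
  next
    fix e assume "e \<in> edges (circ m G P Q)"
    then obtain i where i: "i < m"
      "e \<in> circ_E1 m G P Q i \<union> circ_E2 m P Q i \<union> circ_E4 m G P Q i"
      by (auto simp: circ_def)
    then show "card e = 4"
      by (auto simp: circ_E1_def circ_E2_def circ_E4_def)
    have "e \<subseteq> circ_W m P Q i \<union> circ_W m P Q (Suc i mod m)"
      using i(2) unfolding circ_E1_def circ_E2_def circ_E4_def by blast
    then show "e \<subseteq> verts (circ m G P Q)"
      using S[OF i(1)] i(1) by (auto simp: circ_def)
  qed
qed

end

theory Submission
  imports Defs
begin

text \<open>Let \<open>b\<^sub>i\<close> be the number of fibres of \<open>W\<^sub>i\<close> met by \<open>A\<close> and \<open>s\<^sub>i\<close> the size of the largest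
  intersection of \<open>A\<close> with such a fibre. The edges \<open>E\<^sub>i\<^sup>2\<close> allow only one fibre to be met more than
  once, so \<open>|A \<inter> W\<^sub>i| = b\<^sub>i + s\<^sub>i - \<chi>\<^sub>i\<close>. The largest fibre over \<open>W\<^sub>i\<close> together with the base points of
  \<open>A \<inter> W\<^sub>i\<^sub>+\<^sub>1\<close> is independent in \<open>G\<^sub>i\<^sub>+\<^sub>1\<close>: its edges would lift to \<open>E\<^sub>i\<^sup>1\<close> or \<open>E\<^sub>i\<^sub>+\<^sub>1\<^sup>4\<close>. Hence
  \<open>s\<^sub>i + b\<^sub>i\<^sub>+\<^sub>1 \<le> \<alpha>\<^sub>i\<^sub>+\<^sub>1 - 1 + \<chi>\<^sub>i + \<chi>\<^sub>i\<^sub>+\<^sub>1\<close>, where the hypotheses on the two parts cover the cases in which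
  one \<open>\<chi>\<close> vanishes and give \<open>\<alpha>\<^sub>i\<^sub>+\<^sub>1 \<ge> 1\<close> when both do. Summing around the cycle yields the bound.\<close>

definition layer :: "('i \<times> 'a \<times> 'b) set \<Rightarrow> 'i \<Rightarrow> ('a \<times> 'b) set" where
  "layer A i = {(x, y). (i, x, y) \<in> A}"

lemma in_layer_iff [simp]: "(x, y) \<in> layer A i \<longleftrightarrow> (i, x, y) \<in> A"
  by (simp add: layer_def)

section \<open>Independence numbers of 4-graphs, and a fibre count for relations\<close>

lemma finite_independent_sets:
  assumes "four_graph G"
  shows "finite {S. independent_set G S}"
  by (rule finite_subset[of _ "Pow (verts G)"])
    (use assms in \<open>auto simp: independent_set_def four_graph_def\<close>)

lemma card_le_independence_number:
  assumes "four_graph G" "independent_set G S"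
  shows "card S \<le> independence_number G"
  unfolding independence_number_def
  using finite_independent_sets[OF assms(1)] assms(2) by (intro Max_ge) auto

lemma four_graph_induced: "four_graph G \<Longrightarrow> four_graph (induced G U)"
  by (auto simp: four_graph_def induced_def)

lemma card_le_independence_number_induced:
  assumes "four_graph G" "independent_set G S" "S \<subseteq> U"
  shows "card S \<le> independence_number (induced G U)"
  using assms
  by (intro card_le_independence_number four_graph_induced)
    (auto simp: independent_set_def induced_def)

lemma independent_singleton:
  assumes "four_graph G" "v \<in> verts G"
  shows "independent_set G {v}"
proof -
  have "\<not> e \<subseteq> {v}" if "e \<in> edges G" for e
  proof
    assume "e \<subseteq> {v}"
    then have "card e \<le> 1"
      using card_mono[of "{v}" e] by simp
    then show False
      using assms(1) that by (auto simp: four_graph_def)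
  qed
  then show ?thesis
    using assms(2) by (simp add: independent_set_def)
qed

lemma independence_number_pos_imp_verts:
  assumes "four_graph G" "0 < independence_number G"
  shows "verts G \<noteq> {}"
proof
  assume empty: "verts G = {}"
  have "{} \<notin> edges G"
    using assms(1) by (fastforce simp: four_graph_def)
  then have "{S. independent_set G S} = {{}}"
    using empty assms(1) by (auto simp: independent_set_def)
  then show False
    using assms(2) by (simp add: independence_number_def)
qed

text \<open>The number \<open>a + 1\<close> is positive because \<open>a\<close> bounds a natural
  number, so \<open>G\<close> has a vertex. That vertex alone is independent and lies in one of the
  parts, whose bound is then at least 1.\<close>

lemma one_le_alpha:
  fixes a :: int
  assumes "four_graph G" "verts G = P \<union> Q"
    and "int (independence_number G) = a + 1"
    and "int (independence_number (induced G P)) \<le> a"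
    and "int (independence_number (induced G Q)) \<le> a"
  shows "1 \<le> a"
proof -
  have "0 < independence_number G"
    using assms(3,4) by linarith
  then obtain v where v: "v \<in> verts G"
    using independence_number_pos_imp_verts[OF assms(1)] by blast
  then consider "{v} \<subseteq> P" | "{v} \<subseteq> Q"
    using assms(2) by auto
  then show ?thesis
    by cases (use card_le_independence_number_induced[OF assms(1) independent_singleton[OF assms(1) v]]
        assms(4,5) in fastforce)+
qed

text \<open>All fibres except possibly one are singletons. Taking \<open>x\<close> at the
  exceptional fibre, or anywhere if there is none, the other base points contribute one each. The
  \<open>+ 1\<close> avoids subtraction on naturals.\<close>

lemma card_eq_Domain_plus_fibre:
  assumes "finite R" "R \<noteq> {}"
    and unique: "\<And>x x' y1 y2 y3 y4. \<lbrakk>(x, y1) \<in> R; (x, y2) \<in> R; y1 \<noteq> y2;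
      (x', y3) \<in> R; (x', y4) \<in> R; y3 \<noteq> y4\<rbrakk> \<Longrightarrow> x = x'"
  obtains x where "x \<in> Domain R" "card R + 1 = card (Domain R) + card (R `` {x})"
proof -
  have fin: "finite (Domain R)" "finite (R `` {x})" for x
    using assms(1) by (auto simp: finite_Domain)
  have "\<exists>x\<in>Domain R. \<forall>x'\<in>Domain R - {x}. card (R `` {x'}) = 1"
  proof (cases "\<exists>x y1 y2. (x, y1) \<in> R \<and> (x, y2) \<in> R \<and> y1 \<noteq> y2")
    case True
    then obtain x y1 y2 where x: "(x, y1) \<in> R" "(x, y2) \<in> R" "y1 \<noteq> y2"
      by blast
    have "card (R `` {x'}) = 1" if x': "x' \<in> Domain R - {x}" for x'
    proof -
      obtain y where "(x', y) \<in> R"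
        using x' by auto
      then have "R `` {x'} = {y}"
        using unique[OF x, of x'] x' by auto
      then show ?thesis by simp
    qed
    then show ?thesis
      using x(1) by (meson DomainI)
  next
    case False
    have "card (R `` {x'}) = 1" if x': "x' \<in> Domain R" for x'
    proof -
      obtain y where "(x', y) \<in> R"
        using x' by auto
      then have "R `` {x'} = {y}"
        using False by auto
      then show ?thesis by simp
    qed
    then show ?thesis
      using assms(2) by fast
  qed
  then obtain x where x: "x \<in> Domain R" "\<And>x'. x' \<in> Domain R - {x} \<Longrightarrow> card (R `` {x'}) = 1"
    by blast
  have "R = Sigma (Domain R) (\<lambda>x. R `` {x})"
    by auto
  then have "card R = (\<Sum>x\<in>Domain R. card (R `` {x}))"
    using card_SigmaI[of "Domain R" "\<lambda>x. R `` {x}"] fin by simp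
  also have "\<dots> = card (R `` {x}) + (\<Sum>x'\<in>Domain R - {x}. card (R `` {x'}))"
    using fin(1) x(1) by (rule sum.remove)
  also have "\<dots> = card (R `` {x}) + (card (Domain R) - 1)"
    using x fin(1) by simp
  finally have "card R + 1 = card (Domain R) + card (R `` {x})"
    \<comment> \<open>A nonempty domain makes the truncated subtraction above exact.\<close>
    using card_gt_0_iff[of "Domain R"] x(1) fin(1) by auto
  with x(1) show ?thesis
    by (rule that)
qed

section \<open>Independent sets of the circular construction\<close>

lemma layer_memD:
  assumes "independent_set (circ m G P Q) A" "(i, x, y) \<in> A"
  shows "i < m" "x \<in> P i" "y \<in> Q (Suc i mod m)" "(i, x, y) \<in> circ_W m P Q i"
  using assms by (auto simp: independent_set_def circ_def circ_W_def)

text \<open>Two points in each of two different fibres would form an edge in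
  \<open>circ_E2\<close>.\<close>

lemma circ_layer_unique_fibre:
  assumes A: "independent_set (circ m G P Q) A"
    and mem: "(i, x, y1) \<in> A" "(i, x, y2) \<in> A" "y1 \<noteq> y2"
      "(i, x', y3) \<in> A" "(i, x', y4) \<in> A" "y3 \<noteq> y4"
  shows "x = x'"
proof (rule ccontr)
  assume ne: "x \<noteq> x'"
  let ?e = "{(i, x, y1), (i, x, y2), (i, x', y3), (i, x', y4)}"
  have "card ?e = 4"
    using ne mem by auto
  moreover have "?e \<subseteq> circ_W m P Q i"
    using mem layer_memD(4)[OF A] by blast
  moreover have "\<exists>x1 x2 x3 x4 z1 z2 z3 z4. ?e = {(i, x1, z1), (i, x2, z2), (i, x3, z3), (i, x4, z4)} \<and>
      x1 = x2 \<and> x3 = x4 \<and> x4 \<noteq> x1"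
    by (rule exI[of _ x], rule exI[of _ x], rule exI[of _ x'], rule exI[of _ x'],
        rule exI[of _ y1], rule exI[of _ y2], rule exI[of _ y3], rule exI[of _ y4]) (use ne in simp)
  ultimately have "?e \<in> circ_E2 m P Q i"
    by (simp only: circ_E2_def mem_Collect_eq simp_thms)
  then have "?e \<in> edges (circ m G P Q)"
    using layer_memD(1)[OF A mem(1)] by (auto simp: circ_def)
  moreover have "?e \<subseteq> A"
    using mem by simp
  ultimately show False
    using A by (meson independent_set_def)
qed

text \<open>An edge inside the projected set lifts to four points of \<open>A\<close>. If it meets
  \<open>Q j\<close>, the lift is an edge in \<open>circ_E1\<close>; otherwise it lies over
  \<open>P j\<close> and gives an edge in \<open>circ_E4\<close>.\<close>

lemma circ_independent_projection:
  assumes m: "m \<ge> 2" and i: "i < m" and j: "j = Suc i mod m"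
    and G: "four_graph (G j)" "verts (G j) = P j \<union> Q j" "P j \<inter> Q j = {}"
    and A: "independent_set (circ m G P Q) A"
  shows "independent_set (G j) (layer A i `` {x} \<union> Domain (layer A j))"
  unfolding independent_set_def
proof (intro conjI ballI notI)
  have Y: "layer A i `` {x} \<subseteq> Q j"
    using layer_memD(3)[OF A] j by auto
  have X: "Domain (layer A j) \<subseteq> P j"
    using layer_memD(2)[OF A] by auto
  show "layer A i `` {x} \<union> Domain (layer A j) \<subseteq> verts (G j)"
    using X Y G(2) by blast
  fix e assume e: "e \<in> edges (G j)" "e \<subseteq> layer A i `` {x} \<union> Domain (layer A j)"
  have e4: "card e = 4"
    using G(1) e(1) by (auto simp: four_graph_def)
  \<comment> \<open>With \<open>m = 1\<close> the two indices would coincide and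
    \<open>circ_h i\<close> could not tell the layers apart.\<close>
  have jm: "j < m" and ij: "i \<noteq> j"
    using m i j by (auto simp: mod_Suc)
  have "\<forall>v\<in>Domain (layer A j). \<exists>y. (j, v, y) \<in> A"
    by auto
  then obtain r where r: "\<And>v. v \<in> Domain (layer A j) \<Longrightarrow> (j, v, r v) \<in> A"
    using bchoice[of "Domain (layer A j)" "\<lambda>v y. (j, v, y) \<in> A"] by blast
  \<comment> \<open>A section of \<open>circ_h i\<close> with values in \<open>A\<close> on
    \<open>e\<close>: points of \<open>Q j\<close> go into the fibre over \<open>x\<close>, the
    others to a chosen point of layer \<open>j\<close>. Being a section makes it injective.\<close>
  define g where "g v = (if v \<in> Q j then (i, x, v) else (j, v, r v))" for v
  have gA: "g v \<in> A" if "v \<in> e" for v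
  proof (cases "v \<in> Q j")
    case True
    then have "v \<in> layer A i `` {x}"
      using that e(2) X G(3) by blast
    then show ?thesis
      using True by (auto simp: g_def)
  next
    case False
    then have "v \<in> Domain (layer A j)"
      using that e(2) Y by blast
    then show ?thesis
      using False r by (simp add: g_def)
  qed
  have hg: "circ_h i (g v) = v" for v
    using ij by (auto simp: g_def circ_h_def)
  then have inj: "inj_on g e"
    by (metis inj_onI)
  have card_ge: "card (g ` e) = 4"
    using card_image[OF inj] e4 by simp
  have gW: "g ` e \<subseteq> circ_W m P Q i \<union> circ_W m P Q j"
  proof (intro image_subsetI)
    fix v assume "v \<in> e"
    then show "g v \<in> circ_W m P Q i \<union> circ_W m P Q j"
      using layer_memD(4)[OF A] gA[of v] by (cases "v \<in> Q j") (simp_all add: g_def)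
  qed
  have "g ` e \<in> edges (circ m G P Q)"
  proof (cases "e \<inter> Q j = {}")
    case False
    then obtain v where v: "v \<in> e" "v \<in> Q j"
      by blast
    have xP: "x \<in> P i"
      using gA[OF v(1)] v(2) layer_memD(2)[OF A] by (simp add: g_def)
    \<comment> \<open>Lifts in layer \<open>j\<close> lie in no fibre of layer \<open>i\<close>, and
      all lifts in layer \<open>i\<close> share the base point \<open>x\<close>.\<close>
    have "{x' \<in> P i. circ_fibre m Q i x' \<inter> g ` e \<noteq> {}} = {x}"
    proof (intro equalityI subsetI)
      fix x' assume "x' \<in> {x' \<in> P i. circ_fibre m Q i x' \<inter> g ` e \<noteq> {}}"
      then show "x' \<in> {x}"
        using ij by (auto simp: circ_fibre_def g_def split: if_splits)
    next
      fix x' assume "x' \<in> {x}"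
      moreover have "(i, x, v) \<in> circ_fibre m Q i x \<inter> g ` e"
        using v j by (auto simp: circ_fibre_def g_def intro!: image_eqI[of _ _ v])
      ultimately show "x' \<in> {x' \<in> P i. circ_fibre m Q i x' \<inter> g ` e \<noteq> {}}"
        using xP by blast
    qed
    then have "circ_beta m P Q i (g ` e) = 1"
      by (simp add: circ_beta_def)
    moreover have "circ_h i ` g ` e = e"
      by (simp add: image_image hg)
    ultimately have "g ` e \<in> circ_E1 m G P Q i"
      using card_ge gW e(1) j by (simp add: circ_E1_def)
    then show ?thesis
      using i by (auto simp: circ_def)
  next
    case True
    then have g: "g v = (j, v, r v)" if "v \<in> e" for v
      using that by (auto simp: g_def)
    have "\<exists>xs. set xs = e \<and> distinct xs"
      using e4 by (intro finite_distinct_list) (simp add: card_ge_0_finite)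
    then obtain xs where xs: "set xs = e" "distinct xs"
      by blast
    then have "length xs = 4"
      using e4 distinct_card by fastforce
    then obtain v1 v2 v3 v4 where "xs = [v1, v2, v3, v4]"
      by (auto simp: numeral_eq_Suc length_Suc_conv)
    then have v: "e = {v1, v2, v3, v4}" "distinct [v1, v2, v3, v4]"
      using xs by auto
    have "g ` e = {(j, v1, r v1), (j, v2, r v2), (j, v3, r v3), (j, v4, r v4)}"
      using g v(1) by simp
    then have "\<exists>x1 x2 x3 x4 y1 y2 y3 y4.
        g ` e = {(j, x1, y1), (j, x2, y2), (j, x3, y3), (j, x4, y4)} \<and>
        distinct [x1, x2, x3, x4] \<and> {x1, x2, x3, x4} \<in> edges (G j)"
      by - (rule exI[of _ v1], rule exI[of _ v2], rule exI[of _ v3], rule exI[of _ v4],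
          rule exI[of _ "r v1"], rule exI[of _ "r v2"], rule exI[of _ "r v3"], rule exI[of _ "r v4"],
          use v e(1) in simp)
    moreover have "g ` e \<subseteq> circ_W m P Q j"
      using g gA layer_memD(4)[OF A] by (metis image_subsetI)
    ultimately have "g ` e \<in> circ_E4 m G P Q j"
      using card_ge by (simp only: circ_E4_def mem_Collect_eq simp_thms)
    then show ?thesis
      using jm by (auto simp: circ_def)
  qed
  moreover have "g ` e \<subseteq> A"
    using gA by blast
  ultimately show False
    using A by (meson independent_set_def)
qed

section \<open>Layer sizes and summation around the cycle\<close>

lemma bij_betw_Suc_mod:
  assumes "0 < m"
  shows "bij_betw (\<lambda>i. Suc i mod m) {..<m} {..<m}"
proof -
  have "inj_on (\<lambda>i. Suc i mod m) {..<m}"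
    by (auto simp: inj_on_def mod_Suc split: if_splits)
  moreover have "(\<lambda>i. Suc i mod m) ` {..<m} \<subseteq> {..<m}"
    using assms by auto
  ultimately show ?thesis
    by (simp add: bij_betw_def endo_inj_surj)
qed

lemma card_eq_sum_layers:
  assumes "finite A" "fst ` A \<subseteq> I" "finite I"
  shows "card A = (\<Sum>i\<in>I. card (layer A i))"
proof -
  have "A = Sigma I (layer A)"
    using assms(2) by force
  moreover have "finite (layer A i)" for i
    using finite_imageI[OF assms(1), of snd] by (rule finite_subset[rotated]) force
  ultimately show ?thesis
    using card_SigmaI[of I "layer A"] assms(3) by simp
qed

theorem theorem2:
  fixes m :: nat
    and G :: "nat \<Rightarrow> 'a hypergraph"
    and P Q :: "nat \<Rightarrow> 'a set"
    and a :: "nat \<Rightarrow> int"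
    and A :: "(nat \<times> 'a \<times> 'a) set"
    and chi :: "nat \<Rightarrow> int"
  assumes "m \<ge> 2"
    and "\<And>i. i < m \<Longrightarrow> four_graph (G i)"
    and "\<And>i. i < m \<Longrightarrow> verts (G i) = P i \<union> Q i"
    and "\<And>i. i < m \<Longrightarrow> P i \<inter> Q i = {}"
    and "\<And>i. i < m \<Longrightarrow> int (independence_number (G i)) = a i + 1"
    and "\<And>i. i < m \<Longrightarrow> int (independence_number (induced (G i) (P i))) \<le> a i"
    and "\<And>i. i < m \<Longrightarrow> int (independence_number (induced (G i) (Q i))) \<le> a i"
    and "independent_set (circ m G P Q) A"
    and "\<And>i. i < m \<Longrightarrow> chi i = (if A \<inter> circ_W m P Q i = {} then 0 else 1)"
  shows "int (card A) \<le> (\<Sum>i<m. (a i - 1 + chi i))"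
proof -
  note A = assms(8)
  define b where "b i = int (card (Domain (layer A i)))" for i
  have "finite (verts (circ m G P Q))"
    using four_graph_circ[of m G P Q] assms(2,3) by (simp add: four_graph_def)
  then have finA: "finite A"
    using A finite_subset by (auto simp: independent_set_def)
  have fin: "finite (layer A i)" for i
    using finite_imageI[OF finA, of snd] by (rule finite_subset[rotated]) force
  have chi: "chi i = (if layer A i = {} then 0 else 1)" if "i < m" for i
  proof -
    have "A \<inter> circ_W m P Q i = {} \<longleftrightarrow> layer A i = {}"
      using layer_memD(4)[OF A] by (auto simp: circ_W_def layer_def)
    then show ?thesis
      using assms(9)[OF that] by simp
  qed
  have "\<exists>x. int (card (layer A i)) = b i + int (card (layer A i `` {x})) - chi i"
    if i: "i < m" for i
  proof (cases "layer A i = {}")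
    case True
    \<comment> \<open>For an empty layer every term is zero, so any \<open>x\<close> serves.\<close>
    then show ?thesis
      using chi[OF i] by (simp add: b_def)
  next
    case False
    obtain x where "card (layer A i) + 1 = card (Domain (layer A i)) + card (layer A i `` {x})"
      using card_eq_Domain_plus_fibre[OF fin False] circ_layer_unique_fibre[OF A]
      by (metis in_layer_iff)
    then show ?thesis
      using chi[OF i] False by (intro exI[of _ x]) (simp add: b_def)
  qed
  then obtain x where x: "\<And>i. i < m \<Longrightarrow>
      int (card (layer A i)) = b i + int (card (layer A i `` {x i})) - chi i"
    by metis
  define s where "s i = int (card (layer A i `` {x i}))" for i
  have step: "s i + b (Suc i mod m) \<le> a (Suc i mod m) - 1 + chi i + chi (Suc i mod m)"
    if i: "i < m" for i
  proof -
    define j where "j = Suc i mod m"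
    have j: "j < m"
      using i by (simp add: j_def)
    let ?Y = "layer A i `` {x i}" and ?X = "Domain (layer A j)"
    have Y: "?Y \<subseteq> Q j" and X: "?X \<subseteq> P j"
      using layer_memD(2,3)[OF A] by (auto simp: j_def)
    have ind: "independent_set (G j) (?Y \<union> ?X)"
      by (rule circ_independent_projection[OF assms(1) i j_def assms(2-4)[OF j] A])
    have "?Y \<inter> ?X = {}"
      using X Y assms(4)[OF j] by blast
    then have card: "int (card (?Y \<union> ?X)) = s i + b j"
      using fin by (simp add: card_Un_disjoint s_def b_def finite_Domain)
    \<comment> \<open>The right-hand side is \<open>a j - 1\<close>, \<open>a j\<close> or
      \<open>a j + 1\<close> as zero, one or two of the layers are nonempty.\<close>
    have "s i + b j \<le> a j - 1 + chi i + chi j"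
    proof (cases "layer A i = {}"; cases "layer A j = {}")
      assume "layer A i = {}" "layer A j = {}"
      then show ?thesis
        using one_le_alpha[OF assms(2,3,5-7)[OF j]] chi i j by (simp add: s_def b_def)
    next
      assume *: "layer A i = {}" "layer A j \<noteq> {}"
      then have "?Y \<union> ?X \<subseteq> P j"
        using X by simp
      then have "s i + b j \<le> a j"
        using card_le_independence_number_induced[OF assms(2)[OF j] ind, of "P j"] assms(6)[OF j] card
        by linarith
      then show ?thesis
        using * chi i j by simp
    next
      assume *: "layer A i \<noteq> {}" "layer A j = {}"
      then have "?Y \<union> ?X \<subseteq> Q j"
        using Y by simp
      then have "s i + b j \<le> a j"
        using card_le_independence_number_induced[OF assms(2)[OF j] ind, of "Q j"] assms(7)[OF j] card
        by linarith
      then show ?thesis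
        using * chi i j by simp
    next
      assume *: "layer A i \<noteq> {}" "layer A j \<noteq> {}"
      have "s i + b j \<le> a j + 1"
        using card_le_independence_number[OF assms(2)[OF j] ind] assms(5)[OF j] card
        by linarith
      then show ?thesis
        using * chi i j by simp
    qed
    then show ?thesis
      by (simp add: j_def)
  qed
  have shift: "(\<Sum>i<m. f (Suc i mod m)) = (\<Sum>i<m. f i)" for f :: "nat \<Rightarrow> int"
    using assms(1) by (intro sum.reindex_bij_betw bij_betw_Suc_mod) simp
  have "fst ` A \<subseteq> {..<m}"
    using layer_memD(1)[OF A] by auto
  then have "int (card A) = (\<Sum>i<m. int (card (layer A i)))"
    using card_eq_sum_layers[OF finA] by simp
  also have "\<dots> = (\<Sum>i<m. b i) + (\<Sum>i<m. s i - chi i)"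
    using x by (simp add: s_def flip: sum.distrib) (simp add: algebra_simps)
  \<comment> \<open>Only the \<open>b\<close> terms are rotated, so that each meets the
    \<open>s i\<close> it is paired with in \<open>step\<close>; there \<open>chi i\<close> moves to
    the left.\<close>
  also have "\<dots> = (\<Sum>i<m. b (Suc i mod m) + s i - chi i)"
    by (simp add: shift sum.distrib sum_subtractf)
  also have "\<dots> \<le> (\<Sum>i<m. a (Suc i mod m) - 1 + chi (Suc i mod m))"
    using step by (intro sum_mono) fastforce
  also have "\<dots> = (\<Sum>i<m. a i - 1 + chi i)"
    by (rule shift)
  finally show ?thesis .
qed

end
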